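(* Let $P$ be an upper semilattice (a poset in which any two elements have a join) and let $\to$ be a total binary operation on $P$. Then $(P,\to)$ is a j-extended SP-nearlattice if and only if, for all $x,y,z\in P$, (1) the meet $(x\to y)\wedge(x\vee y)$ exists and $(x\to y)\wedge(x\vee y)=y$; (2) the meet $(z\vee y)\wedge(x\vee y)$ exists and $z\le x\to\bigl((z\vee y)\wedge(x\vee y)\bigr)$.
   Context: A nearlattice is an upper semilattice in which every pair of elements that has a common lower bound has a greatest lower bound. For a poset $P$ and $y\in P$ put $[y)=\{u\in P: y\le u\}$. For $y\le x$, the pseudocomplement $x*y$ of $x$ in $[y)$ is the greatest $u\in[y)$ such that $y$ is the only common lower bound of $u$ and $x$ belonging to $[y)$. $P$ is sectionally pseudocomplemented if $x*y$ exists whenever $y\le x$. $(P,\to)$ is a j-extended SP-nearlattice if $P$ is a nearlattice which is sectionally pseudocomplemented and $x\to y=(x\vee y)*y$ for all $x,y\in P$. *)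

theory Defs
  imports Main
begin

text \<open>
  The library operator \<^const>\<open>Greatest\<close> is a definite description, so it is meaningful only when
  a greatest element exists. Meets and sectional pseudocomplements are partial operations; each is
  given by an existence predicate together with a value.
\<close>

definition has_greatest :: "('a::order \<Rightarrow> bool) \<Rightarrow> bool" where
  "has_greatest Q \<longleftrightarrow> (\<exists>m. Q m \<and> (\<forall>u. Q u \<longrightarrow> u \<le> m))"

definition has_meet :: "'a::order \<Rightarrow> 'a \<Rightarrow> bool" where
  "has_meet a b \<longleftrightarrow> has_greatest (\<lambda>w. w \<le> a \<and> w \<le> b)"

definition meet :: "'a::order \<Rightarrow> 'a \<Rightarrow> 'a" where
  "meet a b = (GREATEST w. w \<le> a \<and> w \<le> b)"

definition nearlattice :: "'a::semilattice_sup itself \<Rightarrow> bool" where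
  "nearlattice _ \<longleftrightarrow> (\<forall>a b :: 'a. (\<exists>c. c \<le> a \<and> c \<le> b) \<longrightarrow> has_meet a b)"

text \<open>
  \<open>disjoint_in_section x y u\<close>: \<open>u\<close> lies in the section \<open>{y..}\<close> and \<open>y\<close> is the only common lower
  bound of \<open>u\<close> and \<open>x\<close> belonging to this section. The pseudocomplement \<open>spc x y\<close> of \<open>x\<close> in the
  section is only meant to be used for \<open>y \<le> x\<close>.
\<close>

definition disjoint_in_section :: "'a::order \<Rightarrow> 'a \<Rightarrow> 'a \<Rightarrow> bool" where
  "disjoint_in_section x y u \<longleftrightarrow> u \<in> {y..} \<and> {w \<in> {y..}. w \<le> u \<and> w \<le> x} = {y}"

definition has_spc :: "'a::order \<Rightarrow> 'a \<Rightarrow> bool" where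
  "has_spc x y \<longleftrightarrow> has_greatest (disjoint_in_section x y)"

definition spc :: "'a::order \<Rightarrow> 'a \<Rightarrow> 'a" where
  "spc x y = Greatest (disjoint_in_section x y)"

definition sectionally_pseudocomplemented :: "'a::order itself \<Rightarrow> bool" where
  "sectionally_pseudocomplemented _ \<longleftrightarrow> (\<forall>x y :: 'a. y \<le> x \<longrightarrow> has_spc x y)"

definition j_extended_SP_nearlattice :: "('a::semilattice_sup \<Rightarrow> 'a \<Rightarrow> 'a) \<Rightarrow> bool" where
  "j_extended_SP_nearlattice imp \<longleftrightarrow>
     nearlattice TYPE('a) \<and> sectionally_pseudocomplemented TYPE('a) \<and>
     (\<forall>x y. imp x y = spc (sup x y) y)"

end

theory Submission
  imports Defs
begin

text \<open>
  In a section, "y is the only common lower bound of u and x" just says that the meet of u and x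
  is y, since any lower bound can be joined with y. So the sectional pseudocomplement is the
  greatest u whose meet with the join of x and y is y. Its maximality is equivalent to the
  inequality in (2): replacing y by the meet m of the joins of z and x with y does not change the
  join with x, and then the join of z and y is a candidate for u in the section of m.
\<close>

text \<open>Existence and value are kept in one conjunction, so that the definite description can be
  eliminated in both directions.\<close>

lemma has_greatest_Greatest_iff:
  "has_greatest Q \<and> Greatest Q = m \<longleftrightarrow> Q m \<and> (\<forall>u. Q u \<longrightarrow> u \<le> m)"
  unfolding has_greatest_def by (metis Greatest_equality)

lemma has_meet_meet_iff:
  "has_meet a b \<and> meet a b = m \<longleftrightarrow> m \<le> a \<and> m \<le> b \<and> (\<forall>w. w \<le> a \<and> w \<le> b \<longrightarrow> w \<le> m)"
  unfolding has_meet_def meet_def has_greatest_Greatest_iff by blast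

lemma has_spc_spc_iff:
  "has_spc x y \<and> spc x y = m \<longleftrightarrow>
    disjoint_in_section x y m \<and> (\<forall>u. disjoint_in_section x y u \<longrightarrow> u \<le> m)"
  unfolding has_spc_def spc_def by (rule has_greatest_Greatest_iff)

lemma disjoint_in_section_iff:
  assumes "y \<le> x"
  shows "disjoint_in_section x y u \<longleftrightarrow> y \<le> u \<and> (\<forall>w. y \<le> w \<and> w \<le> u \<and> w \<le> x \<longrightarrow> w = y)"
  using assms unfolding disjoint_in_section_def by auto

lemma disjoint_in_section_iff_meet:
  fixes x y u :: "'a::semilattice_sup"
  assumes "y \<le> x"
  shows "disjoint_in_section x y u \<longleftrightarrow> has_meet u x \<and> meet u x = y"
proof
  assume "has_meet u x \<and> meet u x = y"
  then show "disjoint_in_section x y u"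
    unfolding has_meet_meet_iff disjoint_in_section_iff[OF assms] by (auto intro: order.antisym)
next
  assume "disjoint_in_section x y u"
  then have yu: "y \<le> u" and only: "\<And>w. y \<le> w \<Longrightarrow> w \<le> u \<Longrightarrow> w \<le> x \<Longrightarrow> w = y"
    unfolding disjoint_in_section_iff[OF assms] by blast+
  have "w \<le> y" if "w \<le> u" "w \<le> x" for w
    using only[of "sup w y"] that yu assms by (metis le_sup_iff sup_ge1 sup_ge2)
  then show "has_meet u x \<and> meet u x = y"
    unfolding has_meet_meet_iff using yu assms by blast
qed

text \<open>If \<open>y \<le> x\<close> then \<open>x = sup x y\<close>, so the values of
  \<open>imp\<close> already cover every sectional pseudocomplement.\<close>

lemma j_extended_SP_nearlattice_iff:
  fixes imp :: "'a::semilattice_sup \<Rightarrow> 'a \<Rightarrow> 'a"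
  shows "j_extended_SP_nearlattice imp \<longleftrightarrow>
    nearlattice TYPE('a) \<and> (\<forall>x y. has_spc (sup x y) y \<and> spc (sup x y) y = imp x y)"
  unfolding j_extended_SP_nearlattice_def sectionally_pseudocomplemented_def
  by (metis sup.absorb1 sup_ge2)

text \<open>A common lower bound \<open>c\<close> of \<open>a\<close> and \<open>b\<close> gives
  \<open>a = sup a c\<close> and \<open>b = sup b c\<close>; conversely, \<open>y\<close> lies below
  both joins.\<close>

lemma nearlattice_iff_has_meet_sup:
  "nearlattice TYPE('a::semilattice_sup) \<longleftrightarrow> (\<forall>x y z :: 'a. has_meet (sup z y) (sup x y))"
  unfolding nearlattice_def by (metis sup.absorb1 sup_ge2)

theorem theorem6p17:
  fixes imp :: "'a::semilattice_sup \<Rightarrow> 'a \<Rightarrow> 'a"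
  shows "j_extended_SP_nearlattice imp \<longleftrightarrow>
    (\<forall>x y z.
       (has_meet (imp x y) (sup x y) \<and> meet (imp x y) (sup x y) = y) \<and>
       (has_meet (sup z y) (sup x y) \<and> z \<le> imp x (meet (sup z y) (sup x y))))"
proof -
  have spc_iff: "has_spc (sup x y) y \<and> spc (sup x y) y = imp x y \<longleftrightarrow>
      (has_meet (imp x y) (sup x y) \<and> meet (imp x y) (sup x y) = y) \<and>
      (\<forall>u. has_meet u (sup x y) \<and> meet u (sup x y) = y \<longrightarrow> u \<le> imp x y)" for x y
    unfolding has_spc_spc_iff by (simp add: disjoint_in_section_iff_meet)
  have greatest_iff: "(\<forall>x y u. has_meet u (sup x y) \<and> meet u (sup x y) = y \<longrightarrow> u \<le> imp x y) \<longleftrightarrow>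
      (\<forall>x y z. z \<le> imp x (meet (sup z y) (sup x y)))" (is "?L \<longleftrightarrow> ?R")
    if near: "nearlattice TYPE('a)"
  proof
    assume L: ?L
    show ?R
    proof (intro allI)
      fix x y z :: 'a
      define m where "m = meet (sup z y) (sup x y)"
      have m: "has_meet (sup z y) (sup x y) \<and> meet (sup z y) (sup x y) = m"
        using near by (simp add: nearlattice_iff_has_meet_sup m_def)
      then have "m \<le> sup x y" and "y \<le> m"
        unfolding has_meet_meet_iff by simp_all
      then have "sup x m = sup x y"
        by (meson order.antisym order.trans sup.bounded_iff sup_ge1 sup_ge2)
      \<comment> \<open>\<open>L\<close> is applied with \<open>m\<close> for \<open>y\<close> and
        \<open>sup z y\<close> for \<open>u\<close>: its premise becomes the fact \<open>m\<close>,
        because \<open>sup x m = sup x y\<close>.\<close>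
      then have "sup z y \<le> imp x m"
        using L m by metis
      then show "z \<le> imp x (meet (sup z y) (sup x y))"
        by (simp add: m_def)
    qed
  next
    assume R: ?R
    show ?L
    proof (intro allI impI)
      fix x y u :: 'a
      assume u: "has_meet u (sup x y) \<and> meet u (sup x y) = y"
      \<comment> \<open>With \<open>u\<close> for \<open>z\<close> in \<open>R\<close>, this
        equation turns the inner meet into \<open>meet u (sup x y)\<close>, which is
        \<open>y\<close>.\<close>
      then have "sup u y = u"
        unfolding has_meet_meet_iff by (simp add: sup.absorb1)
      then show "u \<le> imp x y"
        using R u by metis
    qed
  qed
  show ?thesis
    unfolding j_extended_SP_nearlattice_iff spc_iff
    \<comment> \<open>The existence part of (2) is the nearlattice property, so
      \<open>greatest_iff\<close> is available from either side.\<close>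
    using greatest_iff nearlattice_iff_has_meet_sup[where 'a='a] by blast
qed

end
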